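(* Consider one call of $\mathtt{RefineAMP}$ on a conformingly marked descendant mesh of an initial AMP marked mesh $\mathcal T_0$, with a causal forest. Let a parent event and its causal child bisect $K$ and $T$, respectively, and set $e_1:=e(K)$ and $e_2:=e(T)$ (the refinement edges). If $\operatorname{mgen}(e_1)=q$, then $$\operatorname{mgen}(e_2)\in\{q,q-1\}.$$ In particular, along every root-to-node causal chain the macro-generations of the successive bisection edges are nonincreasing and can decrease by at most one at a time.
   Context: **Notation.** Tetrahedra are closed and nondegenerate in $\mathbb R^3$; $[v_0,v_1,\dots]$ is the convex hull; $\mathcal V(X),\mathcal E(X),\mathcal F(X)$ are the sets of vertices, edges, triangular faces of a tetrahedron or mesh $X$; $\operatorname{mid}(e)$ is the midpoint of $e$. **Marked tetrahedron.** A tetrahedron $K$ with a refinement edge $e(K)\in\mathcal E(K)$, a marked edge $\mu_F\in\mathcal E(F)$ for every $F\in\mathcal F(K)$, and a Boolean flag, such that the two faces containing $e(K)$ (refinement faces) have mark $e(K)$; the flag may be set only if the four face marks are coplanar. The other two faces are the nonrefinement faces. Types: $P$ if all face marks are coplanar ($P_u$ flag unset, $P_f$ flag set); $A$ if the marks of both nonrefinement faces meet $e(K)$ but the four marks are not coplanar; $O$ if neither of these two marks meets $e(K)$; $M$ if exactly one does. **Bisection.** For $K=[v_0,v_1,v_2,v_3]$ with $e(K)=[v_0,v_1]$ and $m=\operatorname{mid}([v_0,v_1])$, the children are $K_0=[v_0,m,v_2,v_3]$ and $K_1=[m,v_1,v_2,v_3]$, marked as follows: (B1) the inherited face of a child (a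 face of $K$) keeps its mark, and this mark is the refinement edge of the child; (B2) a cut face (a proper subtriangle of a face of $K$) is marked by its edge opposite $m$; (B3) the common new face $[m,v_2,v_3]$ is marked by $[v_2,v_3]$, except if $K$ has type $P_f$, when it is marked by $[m,w]$ with $w\in\{v_2,v_3\}$ the common old endpoint of the two child refinement edges; (B4) the child flags are set iff $K$ has type $P_u$. **Meshes.** A tetrahedral mesh of a polyhedral domain $\Omega\subset\mathbb R^3$ is a finite collection of tetrahedra with pairwise disjoint interiors and union $\overline\Omega$. It is conforming if two distinct elements intersect in the empty set, a common vertex, a common edge or a common face. An AMP marked mesh is a mesh of marked tetrahedra; it is conformingly marked if it is conforming and any shared face gets the same mark from both sides. An *initial AMP marked mesh* is a finite conformingly marked AMP mesh with all flags unset. Repeated bisection generates a binary tree below each $K\in\mathcal T_0$; its nodes are the AMP descendants, and $\operatorname{gen}(K)$ is the depth of $K$. A descendant mesh of $\mathcal T_0$ is the mesh of leaves after finitely many bisections starting from $\mathcal T_0$. **RefineAMP.** A hanging vertex of an element $K$ of a current mesh $\mathcal T$ is a vertex $z\in\mathcal V(\mathcal T)$ with $z\in\partial K\setminus\mathcal V(K)$. $\mathtt{RefineAMP}(\mathcal T,\mathcal M)$, for a conformingly marked AMP mesh $\mathcal T$ and $\mathcal M\subseteq\mathcal T$: batch zero bisects all elements of $\mathcal M$; then, as long as some elements of the current mesh have hanging vertices, the next batch simultaneously bisects all of them; return the resulting mesh. **Macro-generation.** $\mathcal U_q$ is the mesh obtained by bisecting uniformly $3q$ times every element of $\mathcal T_0$.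 Known facts (Arnold–Mukherjee–Pouly): each $\mathcal U_q$ is conformingly marked and unflagged; the geometric edges occurring in the uniform refinement tree are partitioned into the sets $\mathcal E(\mathcal U_q)$, $q\ge0$, and $\operatorname{mgen}(e)=q$ iff $e\in\mathcal E(\mathcal U_q)$; if $\operatorname{gen}(K)=3q$ all edges of $K$ have macro-generation $q$, and if $\operatorname{gen}(K)\in\{3q+1,3q+2\}$ every edge of $K$ has macro-generation $q$ or $q+1$. **Causal forest.** Fix one call. Every bisection performed is an event (identified with the tetrahedron bisected); the events of batch zero are the roots. For every non-root event, bisecting $T$, there exist an edge $e\in\mathcal E(T)$ such that $\operatorname{mid}(e)$ is a hanging vertex of $T$ immediately before the event, and an earlier event of the same call that bisected exactly the geometric edge $e$, creating $\operatorname{mid}(e)$. Choose one such earlier event for each non-root event and call it the parent (the non-root event is its causal child). The resulting directed graph is a causal forest of the call, and a causal chain is a directed path in it. *)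

theory Defs
  imports "HOL-Analysis.Analysis"
begin

type_synonym pt = "real ^ 3"

section \<open>Tetrahedra and marked tetrahedra\<close>

text \<open>
  Simplices are represented by their vertex sets: the geometric tetrahedron, face or edge is the
  convex hull of a set of four, three or two points. For affinely independent points the convex
  hull determines the vertex set, so an edge, as a geometric object, is its set of two endpoints.
\<close>

definition is_tetrahedron :: "pt set \<Rightarrow> bool" where
  "is_tetrahedron V \<longleftrightarrow> card V = 4 \<and> \<not> affine_dependent V"

definition edges_of :: "pt set \<Rightarrow> pt set set" where
  "edges_of V = {e. e \<subseteq> V \<and> card e = 2}"

definition faces_of :: "pt set \<Rightarrow> pt set set" where
  "faces_of V = {F. F \<subseteq> V \<and> card F = 3}"

definition edge_mid :: "pt set \<Rightarrow> pt" where
  "edge_mid e = (1 / 2) *\<^sub>R (\<Sum>v\<in>e. v)"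

lemma edge_mid_midpoint: "a \<noteq> b \<Longrightarrow> edge_mid {a, b} = midpoint a b"
  by (simp add: edge_mid_def midpoint_def)

datatype mtet =
  MTet (verts: "pt set") (redge: "pt set") (mark: "pt set \<Rightarrow> pt set") (flag: bool)

abbreviation hull_of :: "mtet \<Rightarrow> pt set" where
  "hull_of K \<equiv> convex hull (verts K)"

abbreviation refinement_faces :: "mtet \<Rightarrow> pt set set" where
  "refinement_faces K \<equiv> {F \<in> faces_of (verts K). redge K \<subseteq> F}"

definition type_P :: "mtet \<Rightarrow> bool" where
  "type_P K \<longleftrightarrow> coplanar (\<Union>F\<in>faces_of (verts K). mark K F)"

definition type_Pu :: "mtet \<Rightarrow> bool" where
  "type_Pu K \<longleftrightarrow> type_P K \<and> \<not> flag K"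

definition type_Pf :: "mtet \<Rightarrow> bool" where
  "type_Pf K \<longleftrightarrow> type_P K \<and> flag K"

text \<open>
  The last conjunct is a normalisation: the mark function carries no data outside the four faces,
  so that marked tetrahedra with the same data are equal.
\<close>

definition marked_tetrahedron :: "mtet \<Rightarrow> bool" where
  "marked_tetrahedron K \<longleftrightarrow>
     is_tetrahedron (verts K) \<and>
     redge K \<in> edges_of (verts K) \<and>
     (\<forall>F \<in> faces_of (verts K). mark K F \<in> edges_of F) \<and>
     (\<forall>F \<in> refinement_faces K. mark K F = redge K) \<and>
     (flag K \<longrightarrow> type_P K) \<and>
     (\<forall>F. F \<notin> faces_of (verts K) \<longrightarrow> mark K F = {})"


section \<open>Bisection\<close>

text \<open>
  Let e be the refinement edge of K and v an endpoint of e. The child of K retaining v has the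
  inherited face \<open>verts K - (e - {v})\<close>, the nonrefinement face of K that contains v. The mark of that
  face is the refinement edge of the child. Hence the point w in the definition of
  \<open>new_face_mark\<close> is the old endpoint common to the two child refinement edges.
\<close>

definition inherited_face :: "mtet \<Rightarrow> pt \<Rightarrow> pt set" where
  "inherited_face K v = verts K - (redge K - {v})"

definition new_face_mark :: "mtet \<Rightarrow> pt set" where
  "new_face_mark K =
     (if type_Pf K
      then {edge_mid (redge K),
            THE w. w \<in> verts K - redge K \<and> (\<forall>v \<in> redge K. w \<in> mark K (inherited_face K v))}
      else verts K - redge K)"

definition child :: "mtet \<Rightarrow> pt \<Rightarrow> mtet" where
  "child K v =
     (let m = edge_mid (redge K);
          H = inherited_face K v;
          N = insert m (verts K - redge K)
      in MTet (insert m H)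
              (mark K H)
              (\<lambda>F. if F \<notin> faces_of (insert m H) then {}
                   else if F = H then mark K H
                   else if F = N then new_face_mark K
                   else F - {m})
              (type_Pu K))"

definition children :: "mtet \<Rightarrow> mtet set" where
  "children K = child K ` redge K"

definition bisect :: "mtet set \<Rightarrow> mtet set \<Rightarrow> mtet set" where
  "bisect S T = (T - S) \<union> (\<Union>K\<in>S. children K)"


section \<open>Meshes\<close>

definition polyhedral_domain :: "pt set \<Rightarrow> bool" where
  "polyhedral_domain \<Omega> \<longleftrightarrow>
     open \<Omega> \<and> connected \<Omega> \<and> \<Omega> \<noteq> {} \<and>
     (\<exists>\<P>. finite \<P> \<and> (\<forall>P\<in>\<P>. polytope P) \<and> closure \<Omega> = \<Union>\<P>)"

definition marked_mesh :: "pt set \<Rightarrow> mtet set \<Rightarrow> bool" where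
  "marked_mesh \<Omega> T \<longleftrightarrow>
     finite T \<and>
     (\<forall>K\<in>T. marked_tetrahedron K) \<and>
     (\<forall>K\<in>T. \<forall>L\<in>T. K \<noteq> L \<longrightarrow> interior (hull_of K) \<inter> interior (hull_of L) = {}) \<and>
     (\<Union>K\<in>T. hull_of K) = closure \<Omega>"

definition conforming :: "mtet set \<Rightarrow> bool" where
  "conforming T \<longleftrightarrow>
     (\<forall>K\<in>T. \<forall>L\<in>T. K \<noteq> L \<longrightarrow>
        hull_of K \<inter> hull_of L = {} \<or>
        (\<exists>z \<in> verts K \<inter> verts L. hull_of K \<inter> hull_of L = {z}) \<or>
        (\<exists>e \<in> edges_of (verts K) \<inter> edges_of (verts L). hull_of K \<inter> hull_of L = convex hull e) \<or>
        (\<exists>F \<in> faces_of (verts K) \<inter> faces_of (verts L). hull_of K \<inter> hull_of L = convex hull F))"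

definition conformingly_marked :: "mtet set \<Rightarrow> bool" where
  "conformingly_marked T \<longleftrightarrow>
     conforming T \<and>
     (\<forall>K\<in>T. \<forall>L\<in>T. \<forall>F \<in> faces_of (verts K) \<inter> faces_of (verts L). mark K F = mark L F)"

definition initial_AMP_mesh :: "pt set \<Rightarrow> mtet set \<Rightarrow> bool" where
  "initial_AMP_mesh \<Omega> T0 \<longleftrightarrow>
     marked_mesh \<Omega> T0 \<and> conformingly_marked T0 \<and> (\<forall>K\<in>T0. \<not> flag K)"

inductive descendant_mesh :: "mtet set \<Rightarrow> mtet set \<Rightarrow> bool" for T0 where
  initial: "descendant_mesh T0 T0"
| bisection: "descendant_mesh T0 T \<Longrightarrow> K \<in> T \<Longrightarrow> descendant_mesh T0 (bisect {K} T)"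

definition mesh_vertices :: "mtet set \<Rightarrow> pt set" where
  "mesh_vertices T = (\<Union>K\<in>T. verts K)"

definition mesh_edges :: "mtet set \<Rightarrow> pt set set" where
  "mesh_edges T = (\<Union>K\<in>T. edges_of (verts K))"


section \<open>Macro-generation\<close>

definition uniform_mesh :: "mtet set \<Rightarrow> nat \<Rightarrow> mtet set" where
  "uniform_mesh T0 q = ((\<lambda>T. bisect T T) ^^ (3 * q)) T0"

text \<open>
  Well defined for edges of the uniform refinement tree of an initial AMP marked mesh, since these
  are partitioned into the sets \<open>mesh_edges (uniform_mesh T0 q)\<close>.
\<close>

definition mgen :: "mtet set \<Rightarrow> pt set \<Rightarrow> nat" where
  "mgen T0 e = (THE q. e \<in> mesh_edges (uniform_mesh T0 q))"


section \<open>RefineAMP and causal forests\<close>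

definition hanging_vertices :: "mtet set \<Rightarrow> mtet \<Rightarrow> pt set" where
  "hanging_vertices T K = mesh_vertices T \<inter> (frontier (hull_of K) - verts K)"

definition nonconforming_elements :: "mtet set \<Rightarrow> mtet set" where
  "nonconforming_elements T = {K\<in>T. hanging_vertices T K \<noteq> {}}"

text \<open>
  \<open>call_mesh T M n\<close> is the current mesh immediately before batch n of the call on T and M. Once no
  element has a hanging vertex, all further batches are empty and the mesh no longer changes, so
  the infinite sequence has exactly the events of the terminating loop.
\<close>

primrec call_mesh :: "mtet set \<Rightarrow> mtet set \<Rightarrow> nat \<Rightarrow> mtet set" where
  "call_mesh T M 0 = T"
| "call_mesh T M (Suc n) =
     bisect (if n = 0 then M else nonconforming_elements (call_mesh T M n)) (call_mesh T M n)"

definition batch :: "mtet set \<Rightarrow> mtet set \<Rightarrow> nat \<Rightarrow> mtet set" where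
  "batch T M n = (if n = 0 then M else nonconforming_elements (call_mesh T M n))"

text \<open>
  \<open>admissible_parent T M n P L\<close>: the event P may be chosen as parent of the event L of batch n.
  Bisections within a batch are simultaneous, so an earlier event is one of an earlier batch.
\<close>

definition admissible_parent :: "mtet set \<Rightarrow> mtet set \<Rightarrow> nat \<Rightarrow> mtet \<Rightarrow> mtet \<Rightarrow> bool" where
  "admissible_parent T M n P L \<longleftrightarrow>
     (\<exists>e \<in> edges_of (verts L).
        edge_mid e \<in> hanging_vertices (call_mesh T M n) L \<and>
        (\<exists>k<n. P \<in> batch T M k) \<and> redge P = e)"

text \<open>A causal forest is given by its set of directed edges (parent, child).\<close>

definition causal_forest :: "mtet set \<Rightarrow> mtet set \<Rightarrow> (mtet \<times> mtet) set \<Rightarrow> bool" where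
  "causal_forest T M G \<longleftrightarrow>
     (\<exists>par. (\<forall>n>0. \<forall>L \<in> batch T M n. admissible_parent T M n (par L) L) \<and>
            G = {(par L, L) | L n. n > 0 \<and> L \<in> batch T M n})"

definition causal_chain :: "(mtet \<times> mtet) set \<Rightarrow> mtet list \<Rightarrow> bool" where
  "causal_chain G Ks \<longleftrightarrow> Ks \<noteq> [] \<and> successively (\<lambda>K L. (K, L) \<in> G) Ks"

definition root_causal_chain ::
    "mtet set \<Rightarrow> mtet set \<Rightarrow> (mtet \<times> mtet) set \<Rightarrow> mtet list \<Rightarrow> bool" where
  "root_causal_chain T M G Ks \<longleftrightarrow> causal_chain G Ks \<and> hd Ks \<in> batch T M 0"

end

(* The macro-generation of an edge is read off from a lattice. For a tetrahedron V let zlat V be the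
   group generated by the differences of its vertices. Three bisections of an unflagged tetrahedron
   cut only edges of that tetrahedron and scale the lattice by 1/2, so an edge of U_q inside an
   element R of T0 is a primitive vector of 2^(-q) zlat R, which determines q. Two elements of T0
   give the same answer for an edge in their intersection, because the lattice of a common face is
   the intersection of the lattice with the direction space of the face.

   Every descendant of generation 3q + r with r < 3 bisects an edge of its ancestor of generation 3q,
   of macro-generation q, while its other edges either belong to that ancestor or survive until
   generation 3q + 3. So the edges of a tetrahedron T have macro-generation mgen(e(T)) or
   mgen(e(T)) + 1, and the parent of T in the causal forest has bisected one of them. *)

theory Submission
  imports Defs
begin

section \<open>Integer difference lattices\<close>

text \<open>The zero-sum condition describes the group of vertex differences without choosing a base
  vertex. On a finite affinely independent \<open>V\<close> the coefficients of a vector are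
  unique.\<close>

definition zlat :: "'a::real_vector set \<Rightarrow> 'a set" where
  "zlat V = {\<Sum>v\<in>V. real_of_int (n v) *\<^sub>R v | n. (\<Sum>v\<in>V. n v) = 0}"

lemma zlatI: "(\<Sum>v\<in>V. n v) = 0 \<Longrightarrow> (\<Sum>v\<in>V. real_of_int (n v) *\<^sub>R v) \<in> zlat V"
  unfolding zlat_def by blast

lemma zlat_zero: "0 \<in> zlat V"
  using zlatI[of "\<lambda>_. 0" V] by simp

lemma zlat_add:
  assumes "x \<in> zlat V" "y \<in> zlat V"
  shows "x + y \<in> zlat V"
proof -
  obtain n n' where "(\<Sum>v\<in>V. n v) = 0" "x = (\<Sum>v\<in>V. real_of_int (n v) *\<^sub>R v)"
    "(\<Sum>v\<in>V. n' v) = 0" "y = (\<Sum>v\<in>V. real_of_int (n' v) *\<^sub>R v)"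
    using assms unfolding zlat_def by blast
  then show ?thesis
    using zlatI[of "\<lambda>v. n v + n' v" V] by (simp add: sum.distrib scaleR_add_left)
qed

lemma zlat_uminus:
  assumes "x \<in> zlat V"
  shows "- x \<in> zlat V"
proof -
  obtain n where "(\<Sum>v\<in>V. n v) = 0" "x = (\<Sum>v\<in>V. real_of_int (n v) *\<^sub>R v)"
    using assms unfolding zlat_def by blast
  then show ?thesis
    using zlatI[of "\<lambda>v. - n v" V] by (simp add: sum_negf)
qed

lemma zlat_diff: "x \<in> zlat V \<Longrightarrow> y \<in> zlat V \<Longrightarrow> x - y \<in> zlat V"
  using zlat_add[of x V "- y"] zlat_uminus[of y V] by simp

lemma zlat_of_nat: "x \<in> zlat V \<Longrightarrow> real k *\<^sub>R x \<in> zlat V"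
  by (induction k) (auto simp: zlat_zero zlat_add scaleR_add_left)

lemma zlat_of_int: "x \<in> zlat V \<Longrightarrow> real_of_int k *\<^sub>R x \<in> zlat V"
proof (cases k)
  case (neg n)
  assume "x \<in> zlat V"
  then have "- (real (Suc n) *\<^sub>R x) \<in> zlat V"
    by (intro zlat_uminus zlat_of_nat)
  moreover have "real_of_int k = - real (Suc n)" by (simp add: neg)
  ultimately show ?thesis by (simp only: scaleR_minus_left)
qed (use zlat_of_nat in simp)

lemma zlat_sum: "(\<And>i. i \<in> I \<Longrightarrow> f i \<in> zlat V) \<Longrightarrow> sum f I \<in> zlat V"
  by (induction I rule: infinite_finite_induct) (auto simp: zlat_zero zlat_add)

lemma zlat_vertex_diff:
  assumes "finite V" "x \<in> V" "y \<in> V"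
  shows "x - y \<in> zlat V"
proof -
  let ?n = "\<lambda>v. (if v = x then 1 else 0) - (if v = y then 1 else 0 :: int)"
  have 1: "(\<Sum>v\<in>V. ?n v) = 0"
    using assms by (simp add: sum_subtractf)
  have 2: "(\<Sum>v\<in>V. real_of_int (?n v) *\<^sub>R v) = x - y"
  proof -
    have "(\<Sum>v\<in>V. real_of_int (?n v) *\<^sub>R v)
        = (\<Sum>v\<in>V. (if v = x then v else 0) - (if v = y then v else 0))"
      by (intro sum.cong) auto
    also have "\<dots> = x - y"
      using assms by (simp add: sum_subtractf)
    finally show ?thesis .
  qed
  show ?thesis
    using zlatI[OF 1] unfolding 2 .
qed

text \<open>As the coefficients sum to zero, \<open>v0\<close> may be subtracted from every vertex,
  so the differences from \<open>v0\<close> generate the group and inclusions can be checked on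
  them. The factor \<open>c\<close> will be 1, 2 and 1/2.\<close>

lemma zlat_least:
  assumes "v0 \<in> V" "x \<in> zlat V" "\<And>v. v \<in> V \<Longrightarrow> c *\<^sub>R (v - v0) \<in> zlat W"
  shows "c *\<^sub>R x \<in> zlat W"
proof -
  obtain n where n: "(\<Sum>v\<in>V. n v) = 0" "x = (\<Sum>v\<in>V. real_of_int (n v) *\<^sub>R v)"
    using assms(2) unfolding zlat_def by blast
  have "(\<Sum>v\<in>V. real_of_int (n v) *\<^sub>R v0) = 0"
    using n(1) by (metis of_int_0 of_int_sum scaleR_left.sum scaleR_zero_left)
  then have "x = (\<Sum>v\<in>V. real_of_int (n v) *\<^sub>R (v - v0))"
    using n(2) by (simp add: scaleR_diff_right sum_subtractf)
  then have "c *\<^sub>R x = (\<Sum>v\<in>V. real_of_int (n v) *\<^sub>R (c *\<^sub>R (v - v0)))"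
    by (simp add: scaleR_right.sum mult.commute)
  also have "\<dots> \<in> zlat W"
    by (intro zlat_sum zlat_of_int assms(3))
  finally show ?thesis .
qed

section \<open>Lattices of affinely independent sets\<close>

lemma affine_independent_coeffs_eq:
  fixes V :: "'a::real_vector set"
  assumes "finite V" "\<not> affine_dependent V"
    and "sum f V = sum g V" "(\<Sum>v\<in>V. f v *\<^sub>R v) = (\<Sum>v\<in>V. g v *\<^sub>R v)" "v \<in> V"
  shows "f v = g v"
proof -
  have "(\<Sum>v\<in>V. f v - g v) = 0" "(\<Sum>v\<in>V. (f v - g v) *\<^sub>R v) = 0"
    using assms(3,4) by (simp_all add: sum_subtractf scaleR_diff_left)
  then have "\<forall>v\<in>V. f v - g v = 0"
    using assms(1,2) unfolding affine_dependent_explicit_finite[OF assms(1)] by metis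
  then show ?thesis using assms(5) by simp
qed

text \<open>By uniqueness the coefficients at \<open>x\<close> and \<open>y\<close> would be 1/2 and
  -1/2. The proof doubles them, so that 1 would have to be even.\<close>

lemma zlat_primitive:
  assumes "finite V" "\<not> affine_dependent V" "x \<in> V" "y \<in> V" "x \<noteq> y"
  shows "(1/2) *\<^sub>R (x - y) \<notin> zlat V"
proof
  assume "(1/2) *\<^sub>R (x - y) \<in> zlat V"
  then obtain n where n: "(\<Sum>v\<in>V. n v) = 0"
    "(1/2) *\<^sub>R (x - y) = (\<Sum>v\<in>V. real_of_int (n v) *\<^sub>R v)"
    unfolding zlat_def by blast
  let ?f = "\<lambda>v. (if v = x then 1 else 0) - (if v = y then 1 else 0 :: real)"
  have "(\<Sum>v\<in>V. ?f v *\<^sub>R v) = (\<Sum>v\<in>V. (if v = x then v else 0) - (if v = y then v else 0))"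
    by (intro sum.cong) auto
  also have "\<dots> = x - y"
    using assms by (simp add: sum_subtractf)
  also have "\<dots> = 2 *\<^sub>R (\<Sum>v\<in>V. real_of_int (n v) *\<^sub>R v)"
    unfolding n(2)[symmetric] by simp
  also have "\<dots> = (\<Sum>v\<in>V. (2 * real_of_int (n v)) *\<^sub>R v)"
    by (simp add: scaleR_right.sum)
  finally have *: "(\<Sum>v\<in>V. ?f v *\<^sub>R v) = (\<Sum>v\<in>V. (2 * real_of_int (n v)) *\<^sub>R v)" .
  have "sum ?f V = 0"
    using assms by (simp add: sum_subtractf)
  moreover have "(\<Sum>v\<in>V. 2 * real_of_int (n v)) = 0"
    using n(1) by (metis mult_zero_right of_int_0 of_int_sum sum_distrib_left)
  ultimately have "?f x = 2 * real_of_int (n x)"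
    using affine_independent_coeffs_eq[OF assms(1,2) _ * assms(3)] by simp
  then have "real_of_int (2 * n x) = real_of_int 1"
    using assms(5) by simp
  then have "2 * n x = 1" by (simp only: of_int_eq_iff)
  then show False by presburger
qed

lemma zlat_mono: "finite V \<Longrightarrow> S \<subseteq> V \<Longrightarrow> zlat S \<subseteq> zlat V"
proof
  fix x assume V: "finite V" "S \<subseteq> V" and x: "x \<in> zlat S"
  show "x \<in> zlat V"
  proof (cases "S = {}")
    case True
    then show ?thesis using x zlat_zero by (auto simp: zlat_def)
  next
    case False
    then obtain s where "s \<in> S" by blast
    then show ?thesis
      using zlat_least[of s S x 1 V] x V zlat_vertex_diff[OF V(1)] by auto
  qed
qed

text \<open>Barycentric coordinates express the vector by real coefficients supported on
  \<open>S\<close>. Uniqueness identifies them with the integer coefficients over \<open>V\<close>,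
  which therefore vanish off \<open>S\<close>. The points range over the hull because endpoints of
  refined edges are in general not vertices of the initial mesh.\<close>

lemma zlat_face:
  assumes "finite V" "\<not> affine_dependent V" "S \<subseteq> V"
    and "x \<in> convex hull S" "y \<in> convex hull S" "c *\<^sub>R (x - y) \<in> zlat V"
  shows "c *\<^sub>R (x - y) \<in> zlat S"
proof -
  have fS: "finite S" using assms finite_subset by blast
  obtain f where f: "sum f S = 1" "(\<Sum>v\<in>S. f v *\<^sub>R v) = x"
    using assms(4) unfolding convex_hull_finite[OF fS] by blast
  obtain g where g: "sum g S = 1" "(\<Sum>v\<in>S. g v *\<^sub>R v) = y"
    using assms(5) unfolding convex_hull_finite[OF fS] by blast
  obtain n where n: "(\<Sum>v\<in>V. n v) = 0" "c *\<^sub>R (x - y) = (\<Sum>v\<in>V. real_of_int (n v) *\<^sub>R v)"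
    using assms(6) unfolding zlat_def by blast
  let ?h = "\<lambda>v. if v \<in> S then c * (f v - g v) else 0"
  have h1: "sum ?h V = 0"
  proof -
    have "sum ?h V = (\<Sum>v\<in>S. c * (f v - g v))"
      by (rule sum.mono_neutral_cong_right) (use assms in auto)
    also have "\<dots> = 0"
      using f g by (simp add: sum_subtractf flip: sum_distrib_left)
    finally show ?thesis .
  qed
  have h2: "(\<Sum>v\<in>V. ?h v *\<^sub>R v) = (\<Sum>v\<in>V. real_of_int (n v) *\<^sub>R v)"
  proof -
    have "(\<Sum>v\<in>V. ?h v *\<^sub>R v) = (\<Sum>v\<in>S. (c * (f v - g v)) *\<^sub>R v)"
      by (rule sum.mono_neutral_cong_right) (use assms in auto)
    also have "\<dots> = c *\<^sub>R (\<Sum>v\<in>S. f v *\<^sub>R v - g v *\<^sub>R v)"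
      by (simp add: scaleR_right.sum scaleR_diff_left scaleR_diff_right right_diff_distrib)
    also have "\<dots> = c *\<^sub>R (x - y)"
      using f g by (simp add: sum_subtractf)
    finally show ?thesis using n(2) by simp
  qed
  have "real_of_int (\<Sum>v\<in>V. n v) = 0" using n(1) by simp
  then have "?h v = real_of_int (n v)" if "v \<in> V" for v
    using affine_independent_coeffs_eq[OF assms(1,2) _ h2 that] h1 by simp
  then have out: "n v = 0" if "v \<in> V - S" for v
    using that by fastforce
  have "(\<Sum>v\<in>S. n v) = (\<Sum>v\<in>V. n v)"
    by (rule sum.mono_neutral_left) (use assms out in auto)
  moreover have "(\<Sum>v\<in>S. real_of_int (n v) *\<^sub>R v) = (\<Sum>v\<in>V. real_of_int (n v) *\<^sub>R v)"
    by (rule sum.mono_neutral_left) (use assms out in auto)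
  ultimately show ?thesis
    using n zlatI[of n S] by simp
qed


section \<open>Three bisections of an unflagged tetrahedron\<close>

text \<open>The part of \<open>marked_tetrahedron\<close> that the induction along the refinement
  tree carries; flags are tracked separately.\<close>

definition premarked :: "mtet \<Rightarrow> bool" where
  "premarked K \<longleftrightarrow>
     is_tetrahedron (verts K) \<and> redge K \<in> edges_of (verts K) \<and>
     (\<forall>F \<in> faces_of (verts K). mark K F \<in> edges_of F)"

text \<open>
  The marking produced by bisecting a tetrahedron that is not of type P_f; m is the new vertex.
\<close>

definition apex_marked :: "mtet \<Rightarrow> pt \<Rightarrow> bool" where
  "apex_marked K m \<longleftrightarrow>
     premarked K \<and> m \<in> verts K \<and> m \<notin> redge K \<and>
     (\<forall>F \<in> faces_of (verts K). m \<in> F \<longrightarrow> mark K F = F - {m}) \<and>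
     mark K (verts K - {m}) = redge K"

section \<open>Geometry of one bisection\<close>

lemma card_Diff_eq:
  assumes "S \<subseteq> A" "card S = k" "card A = k + l" "0 < k"
  shows "card (A - S) = l"
  using assms by (metis card_Diff_subset card_gt_0_iff diff_add_inverse)

lemma premarked_cases:
  assumes "premarked K" "v \<in> redge K"
  obtains u c d where "verts K = {v, u, c, d}" "distinct [v, u, c, d]" "redge K = {v, u}"
proof -
  have V: "card (verts K) = 4" "redge K \<subseteq> verts K" "card (redge K) = 2"
    using assms(1) by (auto simp: premarked_def is_tetrahedron_def edges_of_def)
  obtain u where u: "redge K = {v, u}" "u \<noteq> v"
    using V(3) assms(2) unfolding card_2_iff by (metis empty_iff insertE insert_commute)
  have "card (verts K - redge K) = 2"
    using card_Diff_eq[of "redge K" "verts K" 2 2] V by simp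
  then obtain c d where cd: "verts K - redge K = {c, d}" "c \<noteq> d"
    by (auto simp: card_2_iff)
  have "verts K = {v, u, c, d}"
    using V(2) u cd by auto
  moreover have "distinct [v, u, c, d]"
    using u cd by auto
  ultimately show thesis using u that by blast
qed

lemma child_simps:
  "verts (child K v) = insert (edge_mid (redge K)) (inherited_face K v)"
  "redge (child K v) = mark K (inherited_face K v)"
  "flag (child K v) = type_Pu K"
  "mark (child K v) F =
     (if F \<notin> faces_of (insert (edge_mid (redge K)) (inherited_face K v)) then {}
      else if F = inherited_face K v then mark K (inherited_face K v)
      else if F = insert (edge_mid (redge K)) (verts K - redge K) then new_face_mark K
      else F - {edge_mid (redge K)})"
  by (simp_all add: child_def Let_def)

lemma faces_of_insert:
  assumes "finite H" "card H = 3" "m \<notin> H" "F \<in> faces_of (insert m H)"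
  shows "m \<in> F \<or> F = H"
proof (rule disjCI)
  assume "F \<noteq> H"
  then show "m \<in> F"
    using assms card_subset_eq[of H F] by (auto simp: faces_of_def)
qed

lemma midpoint_diff: "midpoint a b - a = (1/2) *\<^sub>R (b - a)"
proof -
  have "midpoint a b - (1/2) *\<^sub>R (a + a) = (1/2) *\<^sub>R (b - a)"
    by (simp add: midpoint_def flip: scaleR_diff_right del: scaleR_half_double)
  then show ?thesis by simp
qed

text \<open>Otherwise \<open>b\<close>, the reflection of \<open>a\<close> in the midpoint, would be
  an affine combination of two points of the affine hull of \<open>H\<close>.\<close>

lemma midpoint_notin_affine_hull:
  fixes a b :: "'a::real_vector"
  assumes "\<not> affine_dependent (insert b H)" "b \<notin> H" "a \<in> H"
  shows "midpoint a b \<notin> affine hull H"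
proof
  assume m: "midpoint a b \<in> affine hull H"
  have "a \<in> affine hull H" using assms(3) by (simp add: hull_inc)
  then have "2 *\<^sub>R midpoint a b + (-1) *\<^sub>R a \<in> affine hull H"
    using mem_affine[OF affine_affine_hull m, of a 2 "-1"] by simp
  moreover have "2 *\<^sub>R midpoint a b + (-1) *\<^sub>R a = b"
    by (simp add: midpoint_def)
  ultimately show False
    using assms(1,2) unfolding affine_dependent_def
    by (metis Diff_insert_absorb insertI1)
qed

text \<open>The new vertex lies off the plane of the inherited face, so adding it to that face keeps
  affine independence.\<close>

lemma child_tetrahedron:
  assumes "premarked K" "v \<in> redge K"
  shows "card (inherited_face K v) = 3" "inherited_face K v \<in> faces_of (verts K)"
    "edge_mid (redge K) \<notin> verts K" "is_tetrahedron (verts (child K v))"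
proof -
  obtain u c d where K: "verts K = {v, u, c, d}" "distinct [v, u, c, d]" "redge K = {v, u}"
    using premarked_cases[OF assms] .
  have ind: "\<not> affine_dependent {v, u, c, d}"
    using assms(1) K(1) by (simp add: premarked_def is_tetrahedron_def)
  have H: "inherited_face K v = {v, c, d}"
    using K by (auto simp: inherited_face_def)
  have m: "edge_mid (redge K) = midpoint v u"
    using K by (simp add: edge_mid_midpoint)
  show "card (inherited_face K v) = 3" using H K(2) by simp
  show "inherited_face K v \<in> faces_of (verts K)"
    using H K by (auto simp: faces_of_def)
  have out: "midpoint v u \<notin> affine hull {v, c, d}"
    by (rule midpoint_notin_affine_hull) (use ind K(2) in \<open>auto simp: insert_commute\<close>)
  then have *: "midpoint v u \<notin> {v, c, d}"
    by (meson hull_inc)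
  have "midpoint v u \<noteq> u" using K(2) by simp
  with * show "edge_mid (redge K) \<notin> verts K"
    unfolding m K(1) by auto
  have "\<not> affine_dependent {v, c, d}"
    by (rule affine_independent_subset[OF ind]) auto
  then have "\<not> affine_dependent (insert (midpoint v u) {v, c, d})"
    using out by (rule affine_independent_insert)
  moreover have "card (insert (midpoint v u) {v, c, d}) = 4"
    using * K(2) by (subst card_insert_disjoint) auto
  ultimately show "is_tetrahedron (verts (child K v))"
    by (simp add: child_simps H m is_tetrahedron_def)
qed

lemma child_hull_subset:
  assumes "premarked K" "v \<in> redge K"
  shows "hull_of (child K v) \<subseteq> hull_of K"
proof -
  obtain u c d where K: "verts K = {v, u, c, d}" "distinct [v, u, c, d]" "redge K = {v, u}"
    using premarked_cases[OF assms] .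
  have "edge_mid (redge K) \<in> closed_segment v u"
    using K by (simp add: edge_mid_midpoint)
  also have "\<dots> \<subseteq> hull_of K"
    unfolding segment_convex_hull using K by (intro hull_mono) auto
  finally have "edge_mid (redge K) \<in> hull_of K" .
  moreover have "inherited_face K v \<subseteq> hull_of K"
    by (auto simp: inherited_face_def hull_inc)
  ultimately show ?thesis
    by (intro hull_minimal) (auto simp: child_simps convex_convex_hull)
qed

section \<open>Marks, types and flags over three bisections\<close>

lemma coplanar_subset_tetrahedron:
  assumes "is_tetrahedron V" "S \<subseteq> V"
  shows "coplanar S \<longleftrightarrow> S \<noteq> V"
proof
  assume "coplanar S"
  then obtain u v w where S: "S \<subseteq> affine hull {u, v, w}"
    unfolding coplanar_def by blast
  have "aff_dim S \<le> aff_dim {u, v, w}"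
    using aff_dim_subset[OF S] by simp
  also have "\<dots> \<le> int (card {u, v, w}) - 1"
    by (rule aff_dim_le_card) simp
  also have "\<dots> \<le> 2"
    using card_insert_le_m1[of 3 "{v, w}" u] card_insert_le_m1[of 2 "{w}" v] by simp
  finally have "aff_dim S \<le> 2" .
  moreover have "aff_dim V = 3"
    using assms(1) aff_dim_affine_independent[of V] by (simp add: is_tetrahedron_def)
  ultimately show "S \<noteq> V" by auto
next
  assume "S \<noteq> V"
  then obtain x where x: "x \<in> V" "S \<subseteq> V - {x}" using assms(2) by blast
  have "card (V - {x}) = 3"
    using assms(1) x by (simp add: is_tetrahedron_def)
  then obtain u v w where "V - {x} = {u, v, w}"
    by (auto simp: card_3_iff)
  then have "S \<subseteq> affine hull {u, v, w}"
    using x hull_subset[of "{u, v, w}" affine] by auto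
  then show "coplanar S" unfolding coplanar_def by blast
qed

text \<open>The marks consist of vertices of \<open>K\<close>, and vertices of a tetrahedron are
  coplanar exactly when one of the four is missing. Questions about types thus become
  combinatorial.\<close>

lemma type_P_iff:
  assumes "premarked K"
  shows "type_P K \<longleftrightarrow> (\<Union>F\<in>faces_of (verts K). mark K F) \<noteq> verts K"
proof -
  have "(\<Union>F\<in>faces_of (verts K). mark K F) \<subseteq> verts K"
    using assms by (auto simp: premarked_def faces_of_def edges_of_def)
  then show ?thesis
    using coplanar_subset_tetrahedron assms by (simp add: type_P_def premarked_def)
qed

lemma edges_of_mono: "e \<in> edges_of F \<Longrightarrow> F \<subseteq> V \<Longrightarrow> e \<in> edges_of V"
  by (auto simp: edges_of_def)

text \<open>Outside type P_f, rules (B2) and (B3) agree: both mark a face through the new vertex by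
  the edge opposite to it.\<close>

lemma child_apex_marked:
  assumes "premarked K" "\<not> type_Pf K" "v \<in> redge K"
  shows "apex_marked (child K v) (edge_mid (redge K))"
proof -
  let ?m = "edge_mid (redge K)" and ?H = "inherited_face K v"
  note ct = child_tetrahedron[OF assms(1,3)]
  have mH: "?m \<notin> ?H" and fin: "finite ?H"
    using ct(1,3) by (auto simp: inherited_face_def intro: card_ge_0_finite)
  have HE: "mark K ?H \<in> edges_of ?H"
    using assms(1) ct(2) by (simp add: premarked_def)
  have Hf: "?H \<in> faces_of (insert ?m ?H)"
    using ct(1) by (auto simp: faces_of_def)
  have mk: "mark (child K v) F = F - {?m}" if "F \<in> faces_of (insert ?m ?H)" "?m \<in> F" for F
  proof -
    have "?m \<notin> verts K - redge K" using ct(3) by blast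
    then show ?thesis
      using that mH assms(2) by (auto simp: child_simps new_face_mark_def)
  qed
  have mkH: "mark (child K v) ?H = mark K ?H"
    using Hf by (simp add: child_simps)
  have "mark (child K v) F \<in> edges_of F" if "F \<in> faces_of (insert ?m ?H)" for F
  proof (cases "?m \<in> F")
    case True
    then show ?thesis
      using that by (auto simp: mk edges_of_def faces_of_def)
  next
    case False
    then have "F = ?H" using faces_of_insert[OF fin ct(1) mH that] by blast
    then show ?thesis using mkH HE by simp
  qed
  then have "premarked (child K v)"
    using ct(4) edges_of_mono[OF HE subset_insertI]
    by (simp add: premarked_def child_simps(1,2))
  moreover have "?m \<notin> mark K ?H"
    using HE mH by (auto simp: edges_of_def)
  moreover have "insert ?m ?H - {?m} = ?H" using mH by simp
  ultimately show ?thesis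
    using mk mkH by (simp add: apex_marked_def child_simps)
qed

text \<open>No mark contains \<open>m\<close>, so all marks lie in the face opposite
  \<open>m\<close>.\<close>

lemma apex_marked_type_P:
  assumes "apex_marked K m"
  shows "type_P K"
proof -
  have pm: "premarked K" and m: "m \<in> verts K"
    using assms by (auto simp: apex_marked_def)
  have "m \<notin> mark K F" if "F \<in> faces_of (verts K)" for F
  proof (cases "m \<in> F")
    case True
    then show ?thesis using assms that by (simp add: apex_marked_def)
  next
    case False
    then show ?thesis using pm that by (auto simp: premarked_def edges_of_def)
  qed
  then show ?thesis
    using m by (auto simp: type_P_iff[OF pm])
qed

text \<open>Both nonrefinement faces contain \<open>m\<close> and are marked opposite to it. Hence
  the two child refinement edges share the fourth vertex \<open>x\<close>, which is the point w of
  rule (B3).\<close>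

lemma apex_marked_cases:
  assumes "apex_marked K m" "v \<in> redge K"
  obtains u x where "verts K = {m, v, u, x}" "distinct [m, v, u, x]" "redge K = {v, u}"
    "inherited_face K v = {m, v, x}" "mark K (inherited_face K v) = {v, x}"
    "inherited_face K u = {m, u, x}" "mark K (inherited_face K u) = {u, x}"
proof -
  have pm: "premarked K" using assms by (simp add: apex_marked_def)
  obtain u c d where K: "verts K = {v, u, c, d}" "distinct [v, u, c, d]" "redge K = {v, u}"
    using premarked_cases[OF pm assms(2)] .
  have "m \<in> {c, d}"
    using assms(1) K by (auto simp: apex_marked_def)
  then obtain x where x: "verts K = {m, v, u, x}" "distinct [m, v, u, x]"
  proof (cases "m = c")
    case True
    then show ?thesis using that[of d] K by auto
  next
    case False
    then show ?thesis using that[of c] K \<open>m \<in> {c, d}\<close> by auto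
  qed
  have v: "inherited_face K v = {m, v, x}" and u: "inherited_face K u = {m, u, x}"
    using x K(3) by (auto simp: inherited_face_def)
  have "u \<in> redge K" using K by simp
  then have "inherited_face K v \<in> faces_of (verts K)" "inherited_face K u \<in> faces_of (verts K)"
    using child_tetrahedron(2)[OF pm] assms(2) by auto
  then have "mark K (inherited_face K v) = inherited_face K v - {m}"
    "mark K (inherited_face K u) = inherited_face K u - {m}"
    using assms(1) v u by (auto simp: apex_marked_def)
  then show thesis
    using that[OF x K(3) v _ u] x(2) u v by auto
qed

text \<open>With the exceptional mark of the new face, the marks of the child cover all four
  vertices, so they are not coplanar.\<close>

lemma flagged_child:
  assumes "apex_marked K m" "flag K" "v \<in> redge K"
  shows "premarked (child K v)" "\<not> type_P (child K v)" "\<not> flag (child K v)"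
proof -
  have pm: "premarked K" using assms by (simp add: apex_marked_def)
  have Pf: "type_Pf K" using apex_marked_type_P assms by (simp add: type_Pf_def)
  then show "\<not> flag (child K v)" by (simp add: child_simps type_Pf_def type_Pu_def)
  obtain u x where K: "verts K = {m, v, u, x}" "distinct [m, v, u, x]" "redge K = {v, u}"
    "inherited_face K v = {m, v, x}" "mark K (inherited_face K v) = {v, x}"
    "inherited_face K u = {m, u, x}" "mark K (inherited_face K u) = {u, x}"
    using apex_marked_cases[OF assms(1,3)] .
  define n where "n = edge_mid (redge K)"
  have n: "n \<notin> {m, v, u, x}"
    using child_tetrahedron(3)[OF pm assms(3)] K(1) n_def by simp
  have VE: "verts K - redge K = {m, x}" using K by auto
  \<comment> \<open>Of the two candidates, \<open>x\<close> lies on both child refinement edges and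
    \<open>m\<close> on neither.\<close>
  have "(THE w. w \<in> verts K - redge K \<and> (\<forall>v \<in> redge K. w \<in> mark K (inherited_face K v))) = x"
    unfolding VE using K by (intro the_equality) auto
  then have new: "new_face_mark K = {n, x}"
    using Pf by (simp add: new_face_mark_def n_def)
  have V: "verts (child K v) = {n, m, v, x}"
    using K n_def by (simp add: child_simps)
  have dist: "distinct [n, m, v, x]" using n K(2) by auto
  have mk: "mark (child K v) F =
     (if F \<notin> faces_of {n, m, v, x} then {} else if F = {m, v, x} then {v, x}
      else if F = {n, m, x} then {n, x} else F - {n})" for F
    using child_simps(4)[of K v F] unfolding VE new using K n_def by simp
  have f: "{m, v, x} \<in> faces_of {n, m, v, x}" "{n, m, x} \<in> faces_of {n, m, v, x}"
    "{n, m, v} \<in> faces_of {n, m, v, x}"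
    using dist by (auto simp: faces_of_def)
  have mks: "mark (child K v) {m, v, x} = {v, x}" "mark (child K v) {n, m, x} = {n, x}"
    "mark (child K v) {n, m, v} = {m, v}"
    using f dist by (auto simp: mk insert_eq_iff)
  have "mark (child K v) F \<in> edges_of F" if F: "F \<in> faces_of {n, m, v, x}" for F
  proof (cases "n \<in> F \<and> F \<noteq> {n, m, x}")
    case True
    then have "mark (child K v) F = F - {n}"
      using F dist by (auto simp: mk)
    then show ?thesis using F True by (auto simp: edges_of_def faces_of_def)
  next
    case False
    then have "F = {m, v, x} \<or> F = {n, m, x}"
      using faces_of_insert[of "{m, v, x}" n F] F dist by auto
    then show ?thesis using mks dist by (auto simp: edges_of_def)
  qed
  moreover have "redge (child K v) \<in> edges_of (verts (child K v))"
    using K(2,5) V by (auto simp: child_simps edges_of_def)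
  ultimately show pc: "premarked (child K v)"
    using child_tetrahedron(4)[OF pm assms(3)] V by (simp add: premarked_def)
  \<comment> \<open>The marks \<open>{v, x}\<close>, \<open>{n, x}\<close> and \<open>{m, v}\<close>
    already suffice.\<close>
  have "{n, m, v, x} \<subseteq> (\<Union>F\<in>faces_of {n, m, v, x}. mark (child K v) F)"
    using f mks by blast
  moreover have "(\<Union>F\<in>faces_of {n, m, v, x}. mark (child K v) F) \<subseteq> {n, m, v, x}"
    using pc unfolding V premarked_def by (fastforce simp: faces_of_def edges_of_def)
  ultimately have "(\<Union>F\<in>faces_of {n, m, v, x}. mark (child K v) F) = {n, m, v, x}"
    by (rule subset_antisym[rotated])
  then show "\<not> type_P (child K v)"
    by (simp only: type_P_iff[OF pc] V not_not)
qed

text \<open>The child is apex marked, hence of type P. If it is flagged, its children are unflagged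
  and not of type P; if not, it has type P_u and its children are flagged and apex marked. Either
  way the grandchild is not of type P_u.\<close>

lemma grandchild:
  assumes "premarked K" "\<not> flag K" "v \<in> redge K" "w \<in> redge (child K v)"
  shows "premarked (child (child K v) w)" "type_P (child (child K v) w) \<longleftrightarrow> flag (child (child K v) w)"
    "flag (child (child K v) w) \<Longrightarrow>
       apex_marked (child (child K v) w) (edge_mid (redge (child K v)))"
proof -
  let ?C = "child K v"
  have ap: "apex_marked ?C (edge_mid (redge K))"
    using child_apex_marked assms by (simp add: type_Pf_def)
  then have C: "premarked ?C" "type_P ?C"
    using apex_marked_type_P by (auto simp: apex_marked_def)
  have "premarked (child ?C w) \<and> (type_P (child ?C w) \<longleftrightarrow> flag (child ?C w)) \<and>
    (flag (child ?C w) \<longrightarrow> apex_marked (child ?C w) (edge_mid (redge ?C)))"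
  proof (cases "flag ?C")
    case True
    then show ?thesis using flagged_child[OF ap _ assms(4)] by blast
  next
    case False
    then have "apex_marked (child ?C w) (edge_mid (redge ?C))"
      using child_apex_marked[OF C(1) _ assms(4)] by (simp add: type_Pf_def)
    moreover have "flag (child ?C w)"
      using C(2) False by (simp add: child_simps type_Pu_def)
    ultimately show ?thesis
      using apex_marked_type_P by (auto simp: apex_marked_def)
  qed
  then show "premarked (child ?C w)" "type_P (child ?C w) \<longleftrightarrow> flag (child ?C w)"
    "flag (child ?C w) \<Longrightarrow> apex_marked (child ?C w) (edge_mid (redge ?C))" by blast+
qed

text \<open>The flag records whether the grandchild has type P_u, which is impossible. Three
  bisections thus restore the starting situation, which permits induction in steps of three.\<close>

lemma great_grandchild:
  assumes "premarked K" "\<not> flag K" "v \<in> redge K" "w \<in> redge (child K v)"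
    and "z \<in> redge (child (child K v) w)"
  shows "premarked (child (child (child K v) w) z)" "\<not> flag (child (child (child K v) w) z)"
proof -
  let ?C = "child (child K v) w"
  note g = grandchild[OF assms(1-4)]
  show "\<not> flag (child ?C z)"
    using g(2) by (simp add: child_simps type_Pu_def)
  show "premarked (child ?C z)"
  proof (cases "flag ?C")
    case True
    then show ?thesis using flagged_child(1) g(3) assms(5) by blast
  next
    case False
    then have "apex_marked (child ?C z) (edge_mid (redge ?C))"
      using child_apex_marked[OF g(1)] assms(5) by (simp add: type_Pf_def)
    then show ?thesis by (simp add: apex_marked_def)
  qed
qed

text \<open>The second and third bisection edges are old edges of \<open>K\<close>: the first is the
  mark of the inherited face of \<open>K\<close>, and the second is the edge opposite the new vertex
  in a face of the apex marked child. Both lie in the inherited face and meet at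
  \<open>w\<close>.\<close>

lemma grandchild_cases:
  assumes "premarked K" "\<not> flag K" "v \<in> redge K" "w \<in> redge (child K v)"
  obtains u y x where "verts K = insert u {w, y, x}" "inherited_face K v = {w, y, x}"
    "v \<in> {w, y, x}" "distinct [u, w, y, x]" "redge K = {v, u}"
    "redge (child K v) = {w, y}" "redge (child (child K v) w) = {w, x}"
    "verts (child (child K v) w) = {midpoint w y, midpoint v u, w, x}"
proof -
  let ?C = "child K v"
  obtain u c d where K: "verts K = {v, u, c, d}" "distinct [v, u, c, d]" "redge K = {v, u}"
    using premarked_cases[OF assms(1,3)] .
  have H: "inherited_face K v = {v, c, d}"
    using K by (auto simp: inherited_face_def)
  have m: "edge_mid (redge K) = midpoint v u"
    using K by (simp add: edge_mid_midpoint)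
  have ap: "apex_marked ?C (midpoint v u)"
    using child_apex_marked[OF assms(1) _ assms(3)] assms(2) m by (simp add: type_Pf_def)
  obtain y x where C: "verts ?C = {midpoint v u, w, y, x}" "distinct [midpoint v u, w, y, x]"
    "redge ?C = {w, y}" "inherited_face ?C w = {midpoint v u, w, x}"
    "mark ?C (inherited_face ?C w) = {w, x}"
    using apex_marked_cases[OF ap assms(4)] by metis
  have mH: "midpoint v u \<notin> inherited_face K v"
    using child_tetrahedron(3)[OF assms(1,3)] m by (auto simp: inherited_face_def)
  have "insert (midpoint v u) {v, c, d} = insert (midpoint v u) {w, y, x}"
    using C(1) unfolding child_simps m H .
  \<comment> \<open>The new vertex lies in neither triple, so it can be cancelled.\<close>
  then have eq: "{v, c, d} = {w, y, x}"
    using mH C(2) H by (auto simp: insert_eq_iff)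
  show thesis
  proof (rule that)
    show "inherited_face K v = {w, y, x}" using H eq by simp
    show "v \<in> {w, y, x}" using eq by blast
    have "verts K = insert u {v, c, d}" using K by auto
    then show "verts K = insert u {w, y, x}" using eq by simp
    have "u \<notin> {v, c, d}" using K(2) by auto
    then show "distinct [u, w, y, x]" using eq C(2) by simp
    show "redge K = {v, u}" "redge ?C = {w, y}" by fact+
    show "redge (child ?C w) = {w, x}" using C(5) by (simp add: child_simps)
    show "verts (child ?C w) = {midpoint w y, midpoint v u, w, x}"
      using C by (simp add: child_simps edge_mid_midpoint)
  qed
qed

text \<open>
  The three bisected edges form a spanning tree of the edge graph of K, so the halves of their
  difference vectors generate half of the lattice of K.
\<close>

lemma zlat_great_grandchild:
  assumes "premarked K" "\<not> flag K" "v \<in> redge K" "w \<in> redge (child K v)"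
    and "z \<in> redge (child (child K v) w)"
  shows "x \<in> zlat (verts (child (child (child K v) w) z)) \<longleftrightarrow> 2 *\<^sub>R x \<in> zlat (verts K)"
proof -
  obtain u y s where K: "verts K = insert u {w, y, s}" "inherited_face K v = {w, y, s}"
    "v \<in> {w, y, s}" "distinct [u, w, y, s]" "redge K = {v, u}"
    "redge (child K v) = {w, y}" "redge (child (child K v) w) = {w, s}"
    "verts (child (child K v) w) = {midpoint w y, midpoint v u, w, s}"
    using grandchild_cases[OF assms(1-4)] .
  let ?C = "child (child K v) w"
  let ?m = "midpoint v u" and ?n = "midpoint w y" and ?p = "midpoint w s"
  have z: "z = w \<or> z = s" using assms(5) K(7) by auto
  \<comment> \<open>This ensures that dropping an endpoint of \<open>{w, s}\<close> leaves both
    earlier midpoints in the vertex set of the great-grandchild.\<close>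
  have "?m \<noteq> w \<and> ?m \<noteq> s \<and> ?n \<noteq> w \<and> ?n \<noteq> s"
  proof -
    have "card {?n, ?m, w, s} = 4"
      using grandchild(1)[OF assms(1-4)] K(8) by (simp add: premarked_def is_tetrahedron_def)
    then show ?thesis
      by (auto simp: card_insert_if split: if_splits)
  qed
  then have V: "verts (child ?C z) = {?p, ?n, ?m, z}"
    using z K(4,7,8) by (auto simp: child_simps inherited_face_def edge_mid_midpoint)
  let ?L = "zlat {?p, ?n, ?m, z}"
  have d: "?p - z \<in> ?L" "?n - z \<in> ?L" "?m - z \<in> ?L"
    by (simp_all add: zlat_vertex_diff)
  \<comment> \<open>For either retained endpoint \<open>z\<close>, half of the third bisected edge
    is a lattice vector. Doubling it gives \<open>zw\<close>, which moves the base point from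
    \<open>z\<close> to \<open>w\<close>.\<close>
  have hs: "(1/2) *\<^sub>R (s - w) \<in> ?L"
    using z
  proof
    assume "z = w"
    then show ?thesis using d(1) by (simp add: midpoint_diff)
  next
    assume "z = s"
    moreover have "(1/2) *\<^sub>R (s - w) = - (?p - s)"
      using midpoint_diff[of s w] by (simp add: midpoint_sym flip: scaleR_minus_right)
    ultimately show ?thesis using zlat_uminus[OF d(1)] by simp
  qed
  have zw: "z - w \<in> ?L"
    using z
  proof
    assume "z = s"
    then show ?thesis using zlat_of_nat[OF hs, of 2] by simp
  qed (simp add: zlat_zero)
  have nw: "?n - w \<in> ?L" using zlat_add[OF d(2) zw] by simp
  have mw: "?m - w \<in> ?L" using zlat_add[OF d(3) zw] by simp
  have hy: "(1/2) *\<^sub>R (y - w) \<in> ?L"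
    using nw by (simp add: midpoint_diff)
  \<comment> \<open>The vertex \<open>v\<close> is one of \<open>w\<close>, \<open>y\<close> and
    \<open>s\<close>, so this is zero or a vector already treated.\<close>
  have hv: "(1/2) *\<^sub>R (v - w) \<in> ?L"
    using K(3) hs hy by (auto simp: zlat_zero)
  \<comment> \<open>The edge \<open>{v, u}\<close> is joined to \<open>w\<close> through
    \<open>v\<close>: the vector is \<open>?m - w\<close> minus half of
    \<open>v - w\<close>.\<close>
  have hu: "(1/2) *\<^sub>R (u - w) \<in> ?L"
  proof -
    have "(1/2) *\<^sub>R (u - w) = (?m - v) + (v - w) - (1/2) *\<^sub>R (v - w)"
      using scaleR_half_double[of "v - w"] unfolding midpoint_diff
      by (simp add: scaleR_diff_right scaleR_add_right algebra_simps)
    also have "\<dots> = (?m - w) - (1/2) *\<^sub>R (v - w)" by simp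
    finally have "(1/2) *\<^sub>R (u - w) = (?m - w) - (1/2) *\<^sub>R (v - w)" .
    then show ?thesis using zlat_diff[OF mw hv] by simp
  qed
  have half: "(1/2) *\<^sub>R (a - w) \<in> ?L" if "a \<in> verts K" for a
    using that K(1) hs hy hu by (auto simp: zlat_zero)
  have V0: "finite (verts K)" "w \<in> verts K" "v \<in> verts K" "u \<in> verts K" "y \<in> verts K"
    "s \<in> verts K" "z \<in> verts K"
    using K z by auto
  note D = zlat_vertex_diff[OF V0(1)]
  have two: "2 *\<^sub>R (a - z) \<in> zlat (verts K)" if "a \<in> {?p, ?n, ?m, z}" for a
  proof -
    have mid: "2 *\<^sub>R (midpoint b c - z) \<in> zlat (verts K)" if "b \<in> verts K" "c \<in> verts K" for b c
    proof -
      have eq: "2 *\<^sub>R (midpoint b c - z) = (b - z) + (c - z)"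
        by (simp add: midpoint_def scaleR_diff_right scaleR_2)
      show ?thesis unfolding eq by (intro zlat_add D that V0)
    qed
    show ?thesis using that mid V0 by (auto simp: zlat_zero)
  qed
  have zV: "z \<in> {?p, ?n, ?m, z}" by simp
  show ?thesis
    unfolding V
  proof
    assume "x \<in> ?L"
    then show "2 *\<^sub>R x \<in> zlat (verts K)" by (rule zlat_least[OF zV _ two])
  next
    assume "2 *\<^sub>R x \<in> zlat (verts K)"
    then have "(1/2) *\<^sub>R 2 *\<^sub>R x \<in> ?L" by (rule zlat_least[OF V0(2) _ half])
    then show "x \<in> ?L" by simp
  qed
qed


text \<open>An edge other than the refinement edge misses one of its endpoints. The child retaining
  the other endpoint loses only the missed vertex.\<close>

lemma edge_survives:
  assumes "premarked K" "e \<in> edges_of (verts K)" "e \<noteq> redge K"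
  obtains v where "v \<in> redge K" "e \<in> edges_of (verts (child K v))"
proof -
  have R: "card (redge K) = 2" and e: "card e = 2" "e \<subseteq> verts K"
    using assms by (auto simp: premarked_def edges_of_def)
  have "\<not> redge K \<subseteq> e"
    using card_subset_eq[of e "redge K"] R e(1) assms(3) card_ge_0_finite[of e] by auto
  then obtain a where a: "a \<in> redge K" "a \<notin> e" by blast
  have "card (redge K - {a}) = 1" using R a(1) by simp
  then obtain v where "redge K - {a} = {v}" by (auto simp: card_1_singleton_iff)
  then have v: "v \<in> redge K" "redge K - {v} = {a}" using a(1) by auto
  have "e \<subseteq> verts (child K v)"
    using e(2) a(2) v(2) by (auto simp: child_simps inherited_face_def)
  then show thesis using that v(1) e(1) by (simp add: edges_of_def)
qed


section \<open>The uniform refinement tree\<close>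

definition level :: "mtet set \<Rightarrow> nat \<Rightarrow> mtet set" where
  "level T0 n = ((\<lambda>T. bisect T T) ^^ n) T0"

lemma uniform_mesh_level: "uniform_mesh T0 q = level T0 (3 * q)"
  by (simp add: uniform_mesh_def level_def)

lemma level_0: "level T0 0 = T0"
  by (simp add: level_def)

lemma level_Suc: "K \<in> level T0 (Suc n) \<longleftrightarrow> (\<exists>P\<in>level T0 n. \<exists>v\<in>redge P. K = child P v)"
  by (auto simp: level_def bisect_def children_def)

lemma uniform_mesh_Suc:
  "K \<in> uniform_mesh T0 (Suc q) \<longleftrightarrow>
     (\<exists>P\<in>uniform_mesh T0 q. \<exists>v\<in>redge P. \<exists>w\<in>redge (child P v). \<exists>z\<in>redge (child (child P v) w).
        K = child (child (child P v) w) z)"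
proof -
  have eq: "3 * Suc q = Suc (Suc (Suc (3 * q)))" by simp
  show ?thesis unfolding uniform_mesh_level eq Bex_def level_Suc by blast
qed

text \<open>Each block of three bisections restores \<open>premarked\<close> and the unset flag and
  halves the lattice. The hull inclusion ties the lattice to an element \<open>R\<close> that
  contains the descendant.\<close>

lemma uniform_mesh_invariant:
  assumes "initial_AMP_mesh \<Omega> T0" "K \<in> uniform_mesh T0 q"
  shows "premarked K \<and> \<not> flag K \<and>
    (\<exists>R\<in>T0. hull_of K \<subseteq> hull_of R \<and>
       (\<forall>x. x \<in> zlat (verts K) \<longleftrightarrow> 2 ^ q *\<^sub>R x \<in> zlat (verts R)))"
  using assms(2)
proof (induction q arbitrary: K)
  case 0
  then have "K \<in> T0" by (simp add: uniform_mesh_def)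
  then show ?case
    using assms(1)
    by (auto simp: initial_AMP_mesh_def marked_mesh_def marked_tetrahedron_def premarked_def)
next
  case (Suc q)
  then obtain P v w z where P: "P \<in> uniform_mesh T0 q" "v \<in> redge P" "w \<in> redge (child P v)"
    "z \<in> redge (child (child P v) w)" and K: "K = child (child (child P v) w) z"
    unfolding uniform_mesh_Suc by blast
  obtain R where pP: "premarked P" "\<not> flag P" and R: "R \<in> T0" "hull_of P \<subseteq> hull_of R"
    "\<And>x. x \<in> zlat (verts P) \<longleftrightarrow> 2 ^ q *\<^sub>R x \<in> zlat (verts R)"
    using Suc.IH[OF P(1)] by blast
  have "apex_marked (child P v) (edge_mid (redge P))"
    using child_apex_marked[OF pP(1) _ P(2)] pP(2) by (simp add: type_Pf_def)
  then have C: "premarked (child P v)" by (simp add: apex_marked_def)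
  have "hull_of K \<subseteq> hull_of (child (child P v) w)"
    unfolding K using child_hull_subset grandchild(1)[OF pP P(2,3)] P(4) by blast
  also have "\<dots> \<subseteq> hull_of (child P v)" by (rule child_hull_subset[OF C P(3)])
  also have "\<dots> \<subseteq> hull_of P" by (rule child_hull_subset[OF pP(1) P(2)])
  also note R(2)
  finally have "hull_of K \<subseteq> hull_of R" .
  moreover have "x \<in> zlat (verts K) \<longleftrightarrow> 2 ^ Suc q *\<^sub>R x \<in> zlat (verts R)" for x
    unfolding K zlat_great_grandchild[OF pP P(2-4)] R(3) by (simp add: mult.commute)
  ultimately show ?case
    using great_grandchild[OF pP P(2-4)] R(1) K by blast
qed

section \<open>Uniqueness of the macro-generation\<close>

text \<open>The edge vector is primitive in the lattice of its tetrahedron, which is that of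
  \<open>R\<close> scaled by \<open>2 ^ -q\<close>. So among the powers of two that carry it into
  the lattice of \<open>R\<close>, the exponent \<open>q\<close> is least.\<close>

lemma uniform_edge:
  assumes "initial_AMP_mesh \<Omega> T0" "e \<in> mesh_edges (uniform_mesh T0 q)"
  obtains R x y where "R \<in> T0" "e = {x, y}" "x \<in> hull_of R" "y \<in> hull_of R"
    "2 ^ q *\<^sub>R (x - y) \<in> zlat (verts R)" "(2 ^ q / 2) *\<^sub>R (x - y) \<notin> zlat (verts R)"
proof -
  obtain K where K: "K \<in> uniform_mesh T0 q" "e \<in> edges_of (verts K)"
    using assms(2) by (auto simp: mesh_edges_def)
  obtain R where pK: "premarked K" and R: "R \<in> T0" "hull_of K \<subseteq> hull_of R"
    "\<And>x. x \<in> zlat (verts K) \<longleftrightarrow> 2 ^ q *\<^sub>R x \<in> zlat (verts R)"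
    using uniform_mesh_invariant[OF assms(1) K(1)] by blast
  obtain x y where e: "e = {x, y}" "x \<noteq> y" and xy: "x \<in> verts K" "y \<in> verts K"
    using K(2) by (auto simp: edges_of_def card_2_iff)
  have V: "finite (verts K)" "\<not> affine_dependent (verts K)"
    using pK by (auto simp: premarked_def is_tetrahedron_def intro: card_ge_0_finite)
  have "2 ^ q *\<^sub>R (x - y) \<in> zlat (verts R)"
    using zlat_vertex_diff[OF V(1) xy] R(3) by blast
  moreover have "(2 ^ q / 2) *\<^sub>R (x - y) \<notin> zlat (verts R)"
    using zlat_primitive[OF V xy e(2)] unfolding R(3) by simp
  moreover have "x \<in> hull_of R" "y \<in> hull_of R"
    using R(2) xy by (auto simp: hull_inc)
  ultimately show thesis using that R(1) e(1) by blast
qed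

text \<open>Equal elements and empty intersections are included, so that two elements of the initial
  mesh can be compared without case distinctions.\<close>

lemma common_simplex:
  assumes "conforming T" "K \<in> T" "L \<in> T"
  obtains S where "S \<subseteq> verts K" "S \<subseteq> verts L" "hull_of K \<inter> hull_of L \<subseteq> convex hull S"
proof (cases "K = L")
  case True
  then show thesis using that[of "verts K"] by blast
next
  case False
  then consider "hull_of K \<inter> hull_of L = {}"
    | z where "z \<in> verts K \<inter> verts L" "hull_of K \<inter> hull_of L = {z}"
    | e where "e \<in> edges_of (verts K) \<inter> edges_of (verts L)" "hull_of K \<inter> hull_of L = convex hull e"
    | F where "F \<in> faces_of (verts K) \<inter> faces_of (verts L)" "hull_of K \<inter> hull_of L = convex hull F"
    using assms unfolding conforming_def by blast
  then show thesis
  proof cases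
    case 1
    then show thesis using that[of "{}"] by blast
  next
    case (2 z)
    then show thesis using that[of "{z}"] by simp
  next
    case (3 e)
    then show thesis using that[of e] by (simp add: edges_of_def)
  next
    case (4 F)
    then show thesis using that[of F] by (simp add: faces_of_def)
  qed
qed

text \<open>Both endpoints lie in the hull of a common subsimplex \<open>S\<close>, so membership at
  level \<open>q\<close> passes from \<open>R\<close> down to \<open>S\<close> and up to
  \<open>R'\<close>. Multiplying by \<open>2 ^ (p - 1 - q)\<close> contradicts primitivity at level
  \<open>p\<close> in \<open>R'\<close>.\<close>

lemma uniform_edges_disjoint:
  assumes "initial_AMP_mesh \<Omega> T0" "e \<in> mesh_edges (uniform_mesh T0 q)" "q < p"
  shows "e \<notin> mesh_edges (uniform_mesh T0 p)"
proof
  assume e: "e \<in> mesh_edges (uniform_mesh T0 p)"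
  obtain R x y where R: "R \<in> T0" "e = {x, y}" "x \<in> hull_of R" "y \<in> hull_of R"
    "2 ^ q *\<^sub>R (x - y) \<in> zlat (verts R)"
    using uniform_edge[OF assms(1,2)] by metis
  obtain R' x' y' where R': "R' \<in> T0" "e = {x', y'}" "x' \<in> hull_of R'" "y' \<in> hull_of R'"
    "(2 ^ p / 2) *\<^sub>R (x' - y') \<notin> zlat (verts R')"
    using uniform_edge[OF assms(1) e] by metis
  have mesh: "conforming T0" "\<And>K. K \<in> T0 \<Longrightarrow> is_tetrahedron (verts K)"
    using assms(1) by (auto simp: initial_AMP_mesh_def conformingly_marked_def marked_mesh_def
      marked_tetrahedron_def)
  have fin: "finite (verts K) \<and> \<not> affine_dependent (verts K)" if "K \<in> T0" for K
    using mesh(2)[OF that] by (auto simp: is_tetrahedron_def intro: card_ge_0_finite)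
  obtain S where S: "S \<subseteq> verts R" "S \<subseteq> verts R'" "hull_of R \<inter> hull_of R' \<subseteq> convex hull S"
    using common_simplex[OF mesh(1) R(1) R'(1)] .
  \<comment> \<open>The two descriptions of the edge may list its endpoints in opposite order;
    negation in the lattice covers this at the end.\<close>
  have eq: "x' = x \<and> y' = y \<or> x' = y \<and> y' = x"
    using R(2) R'(2) by (metis doubleton_eq_iff)
  have xy: "x \<in> convex hull S" "y \<in> convex hull S"
    using S(3) R(3,4) R'(3,4) eq by blast+
  have "2 ^ q *\<^sub>R (x - y) \<in> zlat S"
    by (rule zlat_face[OF _ _ S(1) xy R(5)]) (use fin[OF R(1)] in auto)
  then have "2 ^ q *\<^sub>R (x - y) \<in> zlat (verts R')"
    using zlat_mono[OF _ S(2)] fin[OF R'(1)] by blast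
  then have "real (2 ^ (p - 1 - q)) *\<^sub>R 2 ^ q *\<^sub>R (x - y) \<in> zlat (verts R')"
    by (rule zlat_of_nat)
  moreover have "real (2 ^ (p - 1 - q)) * 2 ^ q = 2 ^ p / 2"
  proof -
    have "p = Suc ((p - 1 - q) + q)" using assms(3) by simp
    then have "(2::real) ^ p = 2 * (2 ^ (p - 1 - q) * 2 ^ q)"
      by (metis power_Suc power_add)
    then show ?thesis by simp
  qed
  ultimately have *: "(2 ^ p / 2) *\<^sub>R (x - y) \<in> zlat (verts R')"
    by (metis scaleR_scaleR)
  then have "(2 ^ p / 2) *\<^sub>R (y - x) \<in> zlat (verts R')"
    using zlat_uminus[OF *] by (metis minus_diff_eq scaleR_minus_right)
  with * show False using R'(5) eq by auto
qed

lemma mgen_eq: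
  assumes "initial_AMP_mesh \<Omega> T0" "e \<in> mesh_edges (uniform_mesh T0 q)"
  shows "mgen T0 e = q"
  unfolding mgen_def
proof (rule the_equality)
  fix p assume "e \<in> mesh_edges (uniform_mesh T0 p)"
  then show "p = q"
    using uniform_edges_disjoint[OF assms(1)] assms(2) by (metis linorder_neqE_nat)
qed fact

section \<open>Macro-generations inside one element\<close>

text \<open>The value at the refinement edge is \<open>n div 3\<close>: up to two steps after a
  uniform mesh, the refinement edge still belongs to the ancestor in that mesh.\<close>

lemma mgen_level:
  assumes "initial_AMP_mesh \<Omega> T0" "L \<in> level T0 n"
  shows "\<exists>q. mgen T0 (redge L) = q \<and> (\<forall>e\<in>edges_of (verts L). mgen T0 e \<in> {q, Suc q})"
proof -
  let ?q = "n div 3"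
  have mg: "mgen T0 e = p" if "K \<in> uniform_mesh T0 p" "e \<in> edges_of (verts K)" for K p e
    using mgen_eq[OF assms(1)] that by (auto simp: mesh_edges_def)
  have inv: "premarked K" "\<not> flag K" if "K \<in> uniform_mesh T0 ?q" for K
    using uniform_mesh_invariant[OF assms(1) that] by blast+
  \<comment> \<open>Such an edge survives the third bisection and hence belongs to the next uniform
    mesh.\<close>
  have second: "mgen T0 e = Suc ?q"
    if K: "K \<in> uniform_mesh T0 ?q" "v \<in> redge K" "w \<in> redge (child K v)"
      and e: "e \<in> edges_of (verts (child (child K v) w))" "e \<noteq> redge (child (child K v) w)"
    for K v w e
  proof -
    obtain z where "z \<in> redge (child (child K v) w)"
      "e \<in> edges_of (verts (child (child (child K v) w) z))"
      using edge_survives[OF grandchild(1)[OF inv[OF K(1)] K(2,3)] e] .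
    moreover from this have "child (child (child K v) w) z \<in> uniform_mesh T0 (Suc ?q)"
      unfolding uniform_mesh_Suc using K by blast
    ultimately show ?thesis using mg by blast
  qed
  have "n = 3 * ?q \<or> n = Suc (3 * ?q) \<or> n = Suc (Suc (3 * ?q))" by presburger
  then consider (0) "L \<in> uniform_mesh T0 ?q"
    | (1) K v where "K \<in> uniform_mesh T0 ?q" "v \<in> redge K" "L = child K v"
    | (2) K v w where "K \<in> uniform_mesh T0 ?q" "v \<in> redge K" "w \<in> redge (child K v)"
        "L = child (child K v) w"
    using assms(2) unfolding uniform_mesh_level by (metis level_Suc)
  then have "mgen T0 (redge L) = ?q \<and> (\<forall>e\<in>edges_of (verts L). mgen T0 e \<in> {?q, Suc ?q})"
  proof cases
    case 0
    then show ?thesis using mg inv(1) by (auto simp: premarked_def)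
  next
    case (1 K v)
    note K = inv[OF 1(1)]
    let ?m = "edge_mid (redge K)" and ?H = "inherited_face K v"
    have L: "premarked L"
      using child_apex_marked[OF K(1) _ 1(2)] K(2) 1(3) by (simp add: type_Pf_def apex_marked_def)
    have H: "?H \<subseteq> verts K" "?m \<notin> verts K"
      using child_tetrahedron[OF K(1) 1(2)] by (auto simp: faces_of_def)
    have R: "redge L \<in> edges_of ?H"
      using K(1) child_tetrahedron(2)[OF K(1) 1(2)] 1(3) by (simp add: premarked_def child_simps)
    have old: "mgen T0 e = ?q" if "e \<in> edges_of ?H" for e
      using mg[OF 1(1) edges_of_mono[OF that H(1)]] .
    \<comment> \<open>An edge through the new vertex is cut neither now nor in the next bisection,
      as both refinement edges lie in the inherited face. So it reaches the next uniform mesh by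
      \<open>second\<close>.\<close>
    have "mgen T0 e = Suc ?q" if e: "e \<in> edges_of (verts L)" "?m \<in> e" for e
    proof -
      have "e \<noteq> redge L" using R H e(2) by (auto simp: edges_of_def)
      then obtain w where w: "w \<in> redge L" "e \<in> edges_of (verts (child L w))"
        using edge_survives[OF L e(1)] by blast
      have "redge (child L w) \<subseteq> ?H"
        using grandchild_cases[OF K 1(2) w(1)[unfolded 1(3)]] 1(3)
        by (metis insert_commute insert_subset subset_insertI)
      then have "e \<noteq> redge (child L w)" using H e(2) by blast
      then show ?thesis using second[OF 1(1,2)] w 1(3) by blast
    qed
    moreover have "mgen T0 e = ?q" if "e \<in> edges_of (verts L)" "?m \<notin> e" for e
      using old[of e] that 1(3) by (auto simp: child_simps edges_of_def)
    ultimately show ?thesis using old[OF R] by blast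
  next
    case (2 K v w)
    note K = inv[OF 2(1)]
    obtain u y x where *: "verts K = insert u {w, y, x}" "distinct [u, w, y, x]" "redge L = {w, x}"
      using grandchild_cases[OF K 2(2,3)] 2(4) by metis
    then have "redge L \<in> edges_of (verts K)" by (auto simp: edges_of_def)
    then have "mgen T0 (redge L) = ?q" using mg 2(1) by blast
    then show ?thesis using second[OF 2(1-3)] 2(4) by blast
  qed
  then show ?thesis by blast
qed

section \<open>Elements of a call and the causal forest\<close>

text \<open>Elements of an adaptive mesh have different generations, so each is located separately
  in some level of the uniform tree.\<close>

lemma bisect_levels:
  assumes "T \<subseteq> (\<Union>n. level T0 n)" "S \<subseteq> T"
  shows "bisect S T \<subseteq> (\<Union>n. level T0 n)"
proof
  fix L assume "L \<in> bisect S T"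
  then consider "L \<in> T" | K v where "K \<in> T" "v \<in> redge K" "L = child K v"
    using assms(2) by (auto simp: bisect_def children_def)
  then show "L \<in> (\<Union>n. level T0 n)"
  proof cases
    case (2 K v)
    then obtain n where "K \<in> level T0 n" using assms(1) by blast
    then have "L \<in> level T0 (Suc n)" using 2 unfolding level_Suc by blast
    then show ?thesis by blast
  qed (use assms(1) in blast)
qed

lemma descendant_mesh_levels:
  assumes "descendant_mesh T0 T"
  shows "T \<subseteq> (\<Union>n. level T0 n)"
  using assms
proof induction
  case initial
  then show ?case using level_0 by blast
next
  case (bisection T K)
  then show ?case by (intro bisect_levels) auto
qed

lemma batch_subset: "M \<subseteq> T \<Longrightarrow> batch T M n \<subseteq> call_mesh T M n"
  by (auto simp: batch_def nonconforming_elements_def)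

lemma call_mesh_levels:
  assumes "descendant_mesh T0 T" "M \<subseteq> T"
  shows "call_mesh T M n \<subseteq> (\<Union>n. level T0 n)"
proof (induction n)
  case 0
  then show ?case using descendant_mesh_levels[OF assms(1)] by simp
next
  case (Suc n)
  have "call_mesh T M (Suc n) = bisect (batch T M n) (call_mesh T M n)"
    by (simp add: batch_def)
  then show ?case
    using bisect_levels[OF Suc batch_subset[OF assms(2)]] by simp
qed

text \<open>The edge bisected by the parent is an edge of the child \<open>L\<close>, so the
  comparison takes place inside the single element \<open>L\<close>.\<close>

lemma mgen_causal_child:
  assumes "initial_AMP_mesh \<Omega> T0" "descendant_mesh T0 T" "M \<subseteq> T" "causal_forest T M G"
    and "(K, L) \<in> G"
  shows "mgen T0 (redge K) \<in> {mgen T0 (redge L), Suc (mgen T0 (redge L))}"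
proof -
  obtain n where L: "L \<in> batch T M n" and "admissible_parent T M n K L"
    using assms(4,5) unfolding causal_forest_def by blast
  then have e: "redge K \<in> edges_of (verts L)"
    unfolding admissible_parent_def by blast
  obtain k where "L \<in> level T0 k"
    using L batch_subset[OF assms(3)] call_mesh_levels[OF assms(2,3)] by blast
  then show ?thesis using mgen_level[OF assms(1)] e by blast
qed

theorem lemma3p9:
  fixes \<Omega> :: "(real ^ 3) set"
    and T0 T M :: "mtet set"
    and G :: "(mtet \<times> mtet) set"
  assumes "polyhedral_domain \<Omega>"
    and "initial_AMP_mesh \<Omega> T0"
    and "descendant_mesh T0 T"
    and "conformingly_marked T"
    and "M \<subseteq> T"
    and "causal_forest T M G"
  shows "(\<forall>K L q. (K, L) \<in> G \<and> mgen T0 (redge K) = q \<longrightarrow>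
            int (mgen T0 (redge L)) \<in> {int q, int q - 1}) \<and>
         (\<forall>Ks. root_causal_chain T M G Ks \<longrightarrow>
            sorted_wrt (\<ge>) (map (\<lambda>K. mgen T0 (redge K)) Ks) \<and>
            (\<forall>i. Suc i < length Ks \<longrightarrow>
               mgen T0 (redge (Ks ! i)) \<le> mgen T0 (redge (Ks ! Suc i)) + 1))"
proof (intro conjI allI impI)
  note step = mgen_causal_child[OF assms(2,3,5,6)]
  \<comment> \<open>Solving for the value at the child is done in the integers, where subtracting
    one from \<open>q\<close> is not truncated at 0.\<close>
  show "int (mgen T0 (redge L)) \<in> {int q, int q - 1}"
    if "(K, L) \<in> G \<and> mgen T0 (redge K) = q" for K L q
    using step[of K L] that by auto
  fix Ks assume "root_causal_chain T M G Ks"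
  then have chain: "(Ks ! i, Ks ! Suc i) \<in> G" if "Suc i < length Ks" for i
    using that by (simp add: root_causal_chain_def causal_chain_def successively_conv_nth)
  show "mgen T0 (redge (Ks ! i)) \<le> mgen T0 (redge (Ks ! Suc i)) + 1" if "Suc i < length Ks" for i
    using step[OF chain[OF that]] by auto
  have "mgen T0 (redge (Ks ! i)) \<ge> mgen T0 (redge (Ks ! Suc i))" if "Suc i < length Ks" for i
    using step[OF chain[OF that]] by auto
  \<comment> \<open>Transitivity reduces the order of all pairs to that of consecutive
    entries.\<close>
  then show "sorted_wrt (\<ge>) (map (\<lambda>K. mgen T0 (redge K)) Ks)"
    by (subst sorted_wrt_iff_nth_Suc_transp) (auto intro: transpI)
qed

end
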